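(* Let $X$ be a $T_1$ topological space. Then the graph $\Gamma(C(X)_F)$ is neither triangulated nor hyper-triangulated.
   Context: $C(X)_F$ denotes the ring (under pointwise operations) of all functions $f : X \to \mathbb{R}$ for which there is a finite subset $F \subseteq X$ such that the restriction $f|_{X\setminus F}$ is continuous on the subspace $X \setminus F$. $\Gamma(C(X)_F)$ is the zero divisor graph of this ring: its vertices are the nonzero zero divisors of $C(X)_F$, and two vertices $f, g$ are adjacent (joined by an edge) if $fg = 0$. A graph $G$ is called triangulated if every vertex of $G$ is a vertex of a triangle (a cycle of length 3), and hyper-triangulated if every edge of $G$ is an edge of a triangle.
   Formalization: The space X is assumed to have at least two points: if X has at most one point, the ring C(X)_F has no nonzero zero divisors, so the graph is empty and is vacuously both triangulated and hyper-triangulated. *)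

theory Defs
  imports Complex_Main "HOL-Algebra.Ring" "Graph_Theory.Pair_Digraph"
begin

definition C_F :: "('a::topological_space \<Rightarrow> real) ring" where
  "C_F = \<lparr>carrier = {f. \<exists>F. finite F \<and> continuous_on (UNIV - F) f},
          monoid.mult = (\<lambda>f g x. f x * g x), one = (\<lambda>x. 1),
          zero = (\<lambda>x. 0), add = (\<lambda>f g x. f x + g x)\<rparr>"

lemma C_F_simps:
  "f \<in> carrier C_F \<longleftrightarrow> (\<exists>F. finite F \<and> continuous_on (UNIV - F) f)"
  "f \<otimes>\<^bsub>C_F\<^esub> g = (\<lambda>x. f x * g x)"
  "\<one>\<^bsub>C_F\<^esub> = (\<lambda>x. 1)"
  "\<zero>\<^bsub>C_F\<^esub> = (\<lambda>x. 0)"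
  "f \<oplus>\<^bsub>C_F\<^esub> g = (\<lambda>x. f x + g x)"
  by (auto simp: C_F_def)

lemma C_F_carrier_binary:
  assumes "f \<in> carrier C_F" "g \<in> carrier C_F"
    and "\<And>S. continuous_on S f \<Longrightarrow> continuous_on S g \<Longrightarrow> continuous_on S h"
  shows "h \<in> carrier C_F"
proof -
  obtain F G where "finite F" "continuous_on (UNIV - F) f" "finite G" "continuous_on (UNIV - G) g"
    using assms(1,2) unfolding C_F_simps by blast
  then have "finite (F \<union> G)" "continuous_on (UNIV - (F \<union> G)) h"
    by (auto intro!: assms(3) elim!: continuous_on_subset)
  then show ?thesis unfolding C_F_simps by blast
qed

lemma cring_C_F: "cring (C_F :: ('a::topological_space \<Rightarrow> real) ring)"
proof -
  have const: "(\<lambda>x. c) \<in> carrier C_F" for c :: real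
    unfolding C_F_simps by (rule exI[of _ "{}"]) simp
  have add: "f \<oplus>\<^bsub>C_F\<^esub> g \<in> carrier C_F" and mult: "f \<otimes>\<^bsub>C_F\<^esub> g \<in> carrier C_F"
    if "f \<in> carrier C_F" "g \<in> carrier C_F" for f g :: "'a \<Rightarrow> real"
    unfolding C_F_simps(2,5)
    by (rule C_F_carrier_binary[OF that], rule continuous_on_add continuous_on_mult, assumption+)+
  have minus: "\<exists>g\<in>carrier C_F. g \<oplus>\<^bsub>C_F\<^esub> f = \<zero>\<^bsub>C_F\<^esub>"
    if "f \<in> carrier C_F" for f :: "'a \<Rightarrow> real"
  proof
    show "(\<lambda>x. - f x) \<in> carrier C_F"
      by (rule C_F_carrier_binary[OF that that]) (rule continuous_on_minus)
  qed (simp add: C_F_simps(4,5))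
  have zero: "\<zero>\<^bsub>C_F\<^esub> \<in> carrier (C_F :: ('a \<Rightarrow> real) ring)"
    and one: "\<one>\<^bsub>C_F\<^esub> \<in> carrier (C_F :: ('a \<Rightarrow> real) ring)"
    unfolding C_F_simps(3,4) by (rule const)+
  show ?thesis
    by (rule cringI abelian_groupI comm_monoidI; (rule abelian_groupI comm_monoidI)?;
        (rule add mult minus zero one; assumption)?;
        (simp only: C_F_simps(2-5), simp add: fun_eq_iff algebra_simps)?)
qed

definition zero_divisors :: "('r, 'm) ring_scheme \<Rightarrow> 'r set" where
  "zero_divisors R = {a \<in> carrier R. \<exists>b \<in> carrier R. b \<noteq> \<zero>\<^bsub>R\<^esub> \<and> a \<otimes>\<^bsub>R\<^esub> b = \<zero>\<^bsub>R\<^esub>}"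

text \<open>
  Meant for a commutative \<open>R\<close>, so that the arc relation is symmetric. An undirected
  edge is represented by its two opposite arcs. Adjacent vertices are required to be distinct, so
  there are no loops, even if some vertex squares to zero.
\<close>
definition zero_divisor_graph :: "('r, 'm) ring_scheme \<Rightarrow> 'r pair_pre_digraph" where
  "zero_divisor_graph R =
    (let V = zero_divisors R - {\<zero>\<^bsub>R\<^esub>} in
     \<lparr>pverts = V, parcs = {(f, g). f \<in> V \<and> g \<in> V \<and> f \<noteq> g \<and> f \<otimes>\<^bsub>R\<^esub> g = \<zero>\<^bsub>R\<^esub>}\<rparr>)"

definition is_triangle :: "'v pair_pre_digraph \<Rightarrow> ('v \<times> 'v) awalk \<Rightarrow> bool" where
  "is_triangle G p \<longleftrightarrow> pre_digraph.cycle (with_proj G) p \<and> length p = 3"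

text \<open>
  The vertices of a closed walk are the tails of its arcs. In a symmetric graph the reversal of a
  triangle is a triangle, so in \<open>hyper_triangulated\<close> the choice of orientation of an
  edge does not matter.
\<close>
definition triangulated :: "'v pair_pre_digraph \<Rightarrow> bool" where
  "triangulated G \<longleftrightarrow> (\<forall>v \<in> pverts G. \<exists>p. is_triangle G p \<and> v \<in> fst ` set p)"

definition hyper_triangulated :: "'v pair_pre_digraph \<Rightarrow> bool" where
  "hyper_triangulated G \<longleftrightarrow> (\<forall>e \<in> parcs G. \<exists>p. is_triangle G p \<and> e \<in> set p)"

lemma is_triangle_iff:
  assumes "pair_wf_digraph G" "\<And>v. (v, v) \<notin> parcs G"
  shows "is_triangle G p \<longleftrightarrow>
    (\<exists>u v w. p = [(u, v), (v, w), (w, u)] \<and> set p \<subseteq> parcs G \<and> distinct [u, v, w])"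
proof -
  have "u \<in> pverts G" if "(u, v) \<in> parcs G" for u v
    using pair_wf_digraph.in_arcsD1[OF assms(1) that] .
  then show ?thesis
    using assms(2)
    by (auto simp: is_triangle_def pre_digraph.cycle_def pre_digraph.awalk_def cas_with_proj_eq
        awalk_verts_with_proj_eq numeral_3_eq_3 length_Suc_conv)
qed

end

theory Submission
  imports Defs
begin

text \<open>
  The function that vanishes at a single point \<open>a\<close> and is \<open>1\<close> elsewhere lies on no triangle:
  its neighbours are supported on \<open>{a}\<close>, and two functions supported on \<open>{a}\<close> have product
  zero only if one of them is zero (\<open>single_zero_not_in_triangle\<close>). It is a vertex, and it spans
  an edge with the function that is \<open>1\<close> at \<open>a\<close> and \<open>0\<close> elsewhere: both are constant off
  \<open>{a}\<close>, hence belong to the ring, and both are nonzero once the space has two points. This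
  vertex and this edge refute the two properties.
\<close>

lemma triangle_of_zero_divisor_graph_iff:
  "is_triangle (zero_divisor_graph R) p \<longleftrightarrow>
    (\<exists>u v w. p = [(u, v), (v, w), (w, u)] \<and> set p \<subseteq> parcs (zero_divisor_graph R)
      \<and> distinct [u, v, w])"
  by (rule is_triangle_iff) (unfold_locales, auto simp: zero_divisor_graph_def Let_def)

lemma arc_of_C_F_graphD:
  assumes "(f, g) \<in> parcs (zero_divisor_graph C_F)"
  shows "f \<noteq> (\<lambda>x. 0)" "g \<noteq> (\<lambda>x. 0)" "f x * g x = 0"
  using assms by (auto simp: zero_divisor_graph_def Let_def C_F_simps dest: fun_cong)

lemma single_zero_not_in_triangle:
  fixes f :: "'a::topological_space \<Rightarrow> real"
  assumes zero: "\<And>x. f x = 0 \<Longrightarrow> x = a"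
    and triangle: "is_triangle (zero_divisor_graph C_F) p"
  shows "f \<notin> fst ` set p"
proof
  assume "f \<in> fst ` set p"
  then obtain g h where arcs: "(f, g) \<in> parcs (zero_divisor_graph C_F)"
      "(g, h) \<in> parcs (zero_divisor_graph C_F)" "(h, f) \<in> parcs (zero_divisor_graph C_F)"
    using triangle unfolding triangle_of_zero_divisor_graph_iff by auto
  have off: "g x = 0" "h x = 0" if "x \<noteq> a" for x
    using arc_of_C_F_graphD(3)[OF arcs(1), of x] arc_of_C_F_graphD(3)[OF arcs(3), of x]
      zero[of x] that by auto
  have "g a = 0 \<or> h a = 0"
    using arc_of_C_F_graphD(3)[OF arcs(2), of a] by simp
  then have "g = (\<lambda>x. 0) \<or> h = (\<lambda>x. 0)"
    using off by metis
  then show False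
    using arc_of_C_F_graphD(1,2)[OF arcs(2)] by blast
qed

lemma indicator_arc_of_C_F_graph:
  fixes a b :: "'a::topological_space"
  assumes "a \<noteq> b"
  defines "f \<equiv> (\<lambda>x. if x = a then 0 else 1 :: real)"
    and "g \<equiv> (\<lambda>x. if x = a then 1 else 0 :: real)"
  shows "(f, g) \<in> parcs (zero_divisor_graph C_F)"
proof -
  have "continuous_on (UNIV - {a}) f" "continuous_on (UNIV - {a}) g"
    unfolding f_def g_def
    by (rule iffD2[OF continuous_on_cong[OF refl] continuous_on_const], auto)+
  then have carrier: "f \<in> carrier C_F" "g \<in> carrier C_F"
    unfolding C_F_simps by blast+
  have "f b = 1" "g b = 0" "g a = 1"
    using assms by auto
  then have nonzero: "f \<noteq> (\<lambda>x. 0)" "g \<noteq> (\<lambda>x. 0)" "f \<noteq> g"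
    by auto
  have product: "(\<lambda>x. f x * g x) = (\<lambda>x. 0)" "(\<lambda>x. g x * f x) = (\<lambda>x. 0)"
    by (auto simp: f_def g_def)
  have "f \<in> zero_divisors C_F" "g \<in> zero_divisors C_F"
    using carrier nonzero product unfolding zero_divisors_def C_F_simps(2,4) by blast+
  then show ?thesis
    using nonzero product by (simp add: zero_divisor_graph_def Let_def C_F_simps(2,4))
qed

theorem theorem3p13:
  assumes "\<exists>x y :: 'a::t1_space. x \<noteq> y"
  shows "\<not> triangulated (zero_divisor_graph (C_F :: ('a \<Rightarrow> real) ring)) \<and>
    \<not> hyper_triangulated (zero_divisor_graph (C_F :: ('a \<Rightarrow> real) ring))"
proof -
  obtain a b :: 'a where "a \<noteq> b"
    using assms by blast
  define f :: "'a \<Rightarrow> real" where "f = (\<lambda>x. if x = a then 0 else 1)"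
  define g :: "'a \<Rightarrow> real" where "g = (\<lambda>x. if x = a then 1 else 0)"
  have arc: "(f, g) \<in> parcs (zero_divisor_graph C_F)"
    unfolding f_def g_def by (rule indicator_arc_of_C_F_graph[OF \<open>a \<noteq> b\<close>])
  then have vertex: "f \<in> pverts (zero_divisor_graph C_F)"
    by (simp add: zero_divisor_graph_def Let_def)
  have no_triangle: "f \<notin> fst ` set p" if "is_triangle (zero_divisor_graph C_F) p" for p
    using that by (intro single_zero_not_in_triangle[of f a]) (auto simp: f_def split: if_splits)
  then have "(f, g) \<notin> set p" if "is_triangle (zero_divisor_graph C_F) p" for p
    using that by force
  then show ?thesis
    using arc vertex no_triangle unfolding triangulated_def hyper_triangulated_def by blast
qed

end
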